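(* Let $\mathrm{d}$ be a nilpotent operator on a real Hilbert space $W$ with dense domain $V$, and let $f\in W$. If $(w,p)\in V\times\mathfrak{H}$ solves the Hodge–Dirac variational problem for $f$, and $(u,0)\in V\times\mathfrak{H}$ solves the Hodge–Dirac variational problem for $w$, then $(\sigma,u,p)=(w-\mathrm{d}u,\,u,\,p)\in V\times V\times\mathfrak{H}$ solves the Hodge–Laplace mixed variational problem $$\begin{aligned}\langle\sigma,\tau\rangle-\langle u,\mathrm{d}\tau\rangle&=0,&&\forall\tau\in V,\\ \langle\mathrm{d}\sigma,v\rangle+\langle\mathrm{d}u,\mathrm{d}v\rangle+\langle p,v\rangle&=\langle f,v\rangle,&&\forall v\in V,\\ \langle u,q\rangle&=0,&&\forall q\in\mathfrak{H}.\end{aligned}$$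
   Context: $W$ has inner product $\langle\cdot,\cdot\rangle$. A closed, densely defined linear operator $\mathrm{d}$ on $W$ with domain $V=\mathcal{D}(\mathrm{d})$ is nilpotent if its range is contained in its kernel (so $\mathrm{d}^2=0$). Set $\mathfrak{Z}=\ker\mathrm{d}$, $\mathfrak{B}=\operatorname{range}\mathrm{d}$, $\mathfrak{H}=\mathfrak{Z}\cap\mathfrak{B}^{\perp_W}$, where $\perp_W$ is the orthogonal complement in $W$. For $g\in W$, the pair $(y,r)\in V\times\mathfrak{H}$ solves the Hodge–Dirac variational problem for $g$ if $\langle\mathrm{d}y,v\rangle+\langle y,\mathrm{d}v\rangle+\langle r,v\rangle=\langle g,v\rangle$ for all $v\in V$ and $\langle y,q\rangle=0$ for all $q\in\mathfrak{H}$. *)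

theory Defs
  imports "HOL-Analysis.Analysis"
begin

text \<open>
  An unbounded operator on \<open>W\<close> with domain \<open>V\<close> is a total function \<open>d\<close> on the type together with the
  set \<open>V\<close>. Only the values of \<open>d\<close> on \<open>V\<close> are meaningful, and every definition below refers only to
  these.
\<close>

definition op_kernel :: "'a::real_vector set \<Rightarrow> ('a \<Rightarrow> 'a) \<Rightarrow> 'a set"
  where "op_kernel V d = {v \<in> V. d v = 0}"

definition op_range :: "'a set \<Rightarrow> ('a \<Rightarrow> 'a) \<Rightarrow> 'a set"
  where "op_range V d = d ` V"

definition harmonic_space :: "'a::real_inner set \<Rightarrow> ('a \<Rightarrow> 'a) \<Rightarrow> 'a set"
  where "harmonic_space V d = op_kernel V d \<inter> (op_range V d)\<^sup>\<bottom>"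

text \<open>Closedness of the operator is closedness of its graph in \<open>W \<times> W\<close>.\<close>

locale nilpotent_operator =
  fixes V :: "'a::{real_inner, complete_space} set" and d :: "'a \<Rightarrow> 'a"
  assumes domain_subspace: "subspace V"
    and op_add: "\<lbrakk>x \<in> V; y \<in> V\<rbrakk> \<Longrightarrow> d (x + y) = d x + d y"
    and op_scale: "x \<in> V \<Longrightarrow> d (c *\<^sub>R x) = c *\<^sub>R d x"
    and densely_defined: "closure V = UNIV"
    and closed_graph: "closed ((\<lambda>x. (x, d x)) ` V)"
    and range_subset_kernel: "op_range V d \<subseteq> op_kernel V d"

definition solves_hodge_dirac ::
    "'a::real_inner set \<Rightarrow> ('a \<Rightarrow> 'a) \<Rightarrow> 'a \<Rightarrow> 'a \<Rightarrow> 'a \<Rightarrow> bool"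
  where "solves_hodge_dirac V d g y r \<longleftrightarrow>
    y \<in> V \<and> r \<in> harmonic_space V d \<and>
    (\<forall>v\<in>V. d y \<bullet> v + y \<bullet> d v + r \<bullet> v = g \<bullet> v) \<and>
    (\<forall>q\<in>harmonic_space V d. y \<bullet> q = 0)"

definition solves_hodge_laplace_mixed ::
    "'a::real_inner set \<Rightarrow> ('a \<Rightarrow> 'a) \<Rightarrow> 'a \<Rightarrow> 'a \<Rightarrow> 'a \<Rightarrow> 'a \<Rightarrow> bool"
  where "solves_hodge_laplace_mixed V d f \<sigma> u p \<longleftrightarrow>
    \<sigma> \<in> V \<and> u \<in> V \<and> p \<in> harmonic_space V d \<and>
    (\<forall>\<tau>\<in>V. \<sigma> \<bullet> \<tau> - u \<bullet> d \<tau> = 0) \<and>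
    (\<forall>v\<in>V. d \<sigma> \<bullet> v + d u \<bullet> d v + p \<bullet> v = f \<bullet> v) \<and>
    (\<forall>q\<in>harmonic_space V d. u \<bullet> q = 0)"

end

theory Submission
  imports Defs
begin

text \<open>The Hodge-Dirac operator is \<open>d\<close> plus its adjoint, and its square is the
  Hodge Laplacian, so two Dirac solves in succession give a Laplace solve. The problem for
  \<open>w\<close> says weakly that \<sigma> = \<open>w - d u\<close> is the adjoint of
  \<open>d\<close> applied to \<open>u\<close>. Nilpotency (\<open>op_in_domain\<close>,
  \<open>op_op_eq_0\<close>) then turns the Dirac equation for \<open>f\<close> into the second
  mixed equation.\<close>

context nilpotent_operator
begin

lemma op_diff:
  assumes "x \<in> V" "y \<in> V"
  shows "d (x - y) = d x - d y"
  using op_add[OF assms(1) subspace_neg[OF domain_subspace assms(2)]]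
    op_scale[OF assms(2), of "-1"] by simp

text \<open>The kernel lies inside \<open>V\<close> by definition. This puts \<open>w - d u\<close>
  in \<open>V\<close> and makes \<open>d v\<close> an admissible test vector.\<close>

lemma op_in_domain: "x \<in> V \<Longrightarrow> d x \<in> V"
  using range_subset_kernel by (auto simp: op_range_def op_kernel_def)

lemma op_op_eq_0: "x \<in> V \<Longrightarrow> d (d x) = 0"
  using range_subset_kernel by (auto simp: op_range_def op_kernel_def)

end

theorem theorem4p1:
  fixes V :: "'a::{real_inner, complete_space} set"
    and d :: "'a \<Rightarrow> 'a"
    and f w p u :: 'a
  assumes "nilpotent_operator V d"
    and "solves_hodge_dirac V d f w p"
    and "solves_hodge_dirac V d w u 0"
  shows "solves_hodge_laplace_mixed V d f (w - d u) u p"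
proof -
  interpret nilpotent_operator V d by fact
  have w: "w \<in> V" and p: "p \<in> harmonic_space V d"
    and dirac_f: "\<And>v. v \<in> V \<Longrightarrow> d w \<bullet> v + w \<bullet> d v + p \<bullet> v = f \<bullet> v"
    using assms(2) by (auto simp: solves_hodge_dirac_def)
  have u: "u \<in> V" and orth: "\<forall>q\<in>harmonic_space V d. u \<bullet> q = 0"
    and dirac_w: "\<And>v. v \<in> V \<Longrightarrow> d u \<bullet> v + u \<bullet> d v = w \<bullet> v"
    using assms(3) by (auto simp: solves_hodge_dirac_def)
  have \<sigma>: "w - d u \<in> V"
    using domain_subspace w op_in_domain[OF u] by (rule subspace_diff)
  have "(w - d u) \<bullet> v - u \<bullet> d v = 0" if "v \<in> V" for v
    using dirac_w[OF that] by (simp add: inner_diff_left)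
  moreover have "d (w - d u) \<bullet> v + d u \<bullet> d v + p \<bullet> v = f \<bullet> v" if v: "v \<in> V" for v
  proof -
    have "d (w - d u) = d w"
      using w u by (simp add: op_diff op_in_domain op_op_eq_0)
    \<comment> \<open>Test the equation for \<open>w\<close> with \<open>d v\<close> in place of
      \<open>v\<close>: the term with \<open>d (d v)\<close> vanishes.\<close>
    moreover have "d u \<bullet> d v = w \<bullet> d v"
      using dirac_w[OF op_in_domain[OF v]] op_op_eq_0[OF v] by simp
    ultimately show ?thesis
      using dirac_f[OF v] by simp
  qed
  ultimately show ?thesis
    using \<sigma> u p orth by (simp add: solves_hodge_laplace_mixed_def)
qed

end
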